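(* Let $(\Phi^{(j)})_{j=1}^\infty$ be a non-autonomous IFS on a compact metric space $X$, and let $0\le j<k<\ell$. For the subcomplex $\mathcal M_{j,k,\ell}$ of the nerve $\mathcal N_{j,\ell}$ there is a long exact sequence of homology groups $$\cdots\xrightarrow{\ \partial\ }H_q(\mathcal M_{j,k,\ell})\xrightarrow{\ \iota\ }H_q(\mathcal N_{j,\ell})\xrightarrow{\ \varpi\ }H_q(\mathcal N_{j,\ell},\mathcal M_{j,k,\ell})\xrightarrow{\ \partial\ }H_{q-1}(\mathcal M_{j,k,\ell})\longrightarrow\cdots,$$ where $\iota$ is induced by the inclusion and $\varpi$ is induced by the quotient map.
   Context: Let $X$ be a non-empty compact metric space; $\mathrm{Lip}(f)$ denotes the Lipschitz constant of $f\colon X\to X$. A non-autonomous IFS $(\Phi^{(j)})_{j\ge1}$ on $X$ is a sequence of collections $\Phi^{(j)}=\{f^{(j)}_i\colon X\to X\}_{i\in I^{(j)}}$ of maps, with each index set $I^{(j)}$ finite and non-empty, such that there is a constant $c<1$ with $\mathrm{Lip}(f^{(j)}_i)\le c$ for all $j\ge1$, $i\in I^{(j)}$. Its coding map $\Pi\colon\prod_{j\ge1}I^{(j)}\to X$ is defined by $\{\Pi(i_1,i_2,\dots)\}=\bigcap_{j\ge1}f^{(1)}_{i_1}\circ\cdots\circ f^{(j)}_{i_j}(X)$, and its limit set is $J=\Pi(\prod_{j\ge1}I^{(j)})$. For $j\ge0$, $J_j$ denotes the limit set of the shifted system $(\Phi^{(j+k)})_{k\ge1}$, so $J_0=J$.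 For $0\le j<k$ and $v=(i_{j+1},\dots,i_k)\in I^{(j+1)}\times\cdots\times I^{(k)}$ put $f_v=f^{(j+1)}_{i_{j+1}}\circ\cdots\circ f^{(k)}_{i_k}$. The nerve $\mathcal N_{j,k}$ is the abstract simplicial complex with vertex set $V(\mathcal N_{j,k})=I^{(j+1)}\times\cdots\times I^{(k)}$, in which a set $\{v_0,\dots,v_q\}$ of mutually distinct vertices is a simplex iff $\bigcap_{p=0}^q f_{v_p}(J_k)\ne\emptyset$. For $0\le j<k<\ell$ and $u\in V(\mathcal N_{j,k})$, let $\xi_u\colon V(\mathcal N_{k,\ell})\to V(\mathcal N_{j,\ell})$ be the concatenation map $\xi_u(v)=uv$; it is injective and induces a simplicial map $\mathcal N_{k,\ell}\to\mathcal N_{j,\ell}$. The $(j,k,\ell)$-subcomplex of $\mathcal N_{j,\ell}$ is $\mathcal M_{j,k,\ell}=\bigcup_{u\in V(\mathcal N_{j,k})}\xi_u(\mathcal N_{k,\ell})$. Homology is simplicial homology with $\mathbb Z$ coefficients, and $\partial$ is the connecting homomorphism. *)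

theory Defs
  imports
    "HOL-Analysis.Lipschitz"
    "HOL-Algebra.Free_Abelian_Groups"
    "HOL-Combinatorics.Permutations"
begin

section \<open>Non-autonomous iterated function systems\<close>

text \<open>
  The families are indexed by \<open>j \<ge> 1\<close>; the values of \<open>I\<close> and \<open>f\<close> at \<open>0\<close> are never used.
\<close>

definition nonautonomous_IFS ::
    "'a::metric_space set \<Rightarrow> (nat \<Rightarrow> 'i set) \<Rightarrow> (nat \<Rightarrow> 'i \<Rightarrow> 'a \<Rightarrow> 'a) \<Rightarrow> bool" where
  "nonautonomous_IFS X I f \<longleftrightarrow>
     compact X \<and> X \<noteq> {} \<and>
     (\<forall>j\<ge>1. finite (I j) \<and> I j \<noteq> {} \<and> (\<forall>i\<in>I j. f j i ` X \<subseteq> X)) \<and>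
     (\<exists>c<1. \<forall>j\<ge>1. \<forall>i\<in>I j. c-lipschitz_on X (f j i))"

text \<open>The word \<open>[i\<^bsub>j+1\<^esub>, \<dots>, i\<^bsub>k\<^esub>]\<close> acts as \<open>f (j+1) i\<^bsub>j+1\<^esub> \<circ> \<dots> \<circ> f k i\<^bsub>k\<^esub>\<close>.\<close>

fun word_map :: "(nat \<Rightarrow> 'i \<Rightarrow> 'a \<Rightarrow> 'a) \<Rightarrow> nat \<Rightarrow> 'i list \<Rightarrow> 'a \<Rightarrow> 'a" where
  "word_map f j [] = id"
| "word_map f j (i # v) = f (Suc j) i \<circ> word_map f (Suc j) v"

definition words :: "(nat \<Rightarrow> 'i set) \<Rightarrow> nat \<Rightarrow> nat \<Rightarrow> 'i list set" where
  "words I j k = {v. length v = k - j \<and> (\<forall>n < k - j. v ! n \<in> I (j + n + 1))}"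

definition coding_map ::
    "'a set \<Rightarrow> (nat \<Rightarrow> 'i \<Rightarrow> 'a \<Rightarrow> 'a) \<Rightarrow> (nat \<Rightarrow> 'i) \<Rightarrow> 'a" where
  "coding_map X f \<omega> = the_elem (\<Inter>j\<in>{1..}. word_map f 0 (map \<omega> [1..<Suc j]) ` X)"

definition limit_set ::
    "'a set \<Rightarrow> (nat \<Rightarrow> 'i set) \<Rightarrow> (nat \<Rightarrow> 'i \<Rightarrow> 'a \<Rightarrow> 'a) \<Rightarrow> 'a set" where
  "limit_set X I f = coding_map X f ` (\<Pi>\<^sub>E j\<in>{1..}. I j)"

definition shifted_limit_set ::
    "'a set \<Rightarrow> (nat \<Rightarrow> 'i set) \<Rightarrow> (nat \<Rightarrow> 'i \<Rightarrow> 'a \<Rightarrow> 'a) \<Rightarrow> nat \<Rightarrow> 'a set" where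
  "shifted_limit_set X I f j = limit_set X (\<lambda>k. I (j + k)) (\<lambda>k. f (j + k))"

text \<open>
  An abstract simplicial complex is represented by its set of (finite, non-empty) simplices.
\<close>

definition nerve ::
    "'a set \<Rightarrow> (nat \<Rightarrow> 'i set) \<Rightarrow> (nat \<Rightarrow> 'i \<Rightarrow> 'a \<Rightarrow> 'a) \<Rightarrow> nat \<Rightarrow> nat \<Rightarrow> 'i list set set" where
  "nerve X I f j k =
     {S. finite S \<and> S \<noteq> {} \<and> S \<subseteq> words I j k \<and>
         (\<Inter>v\<in>S. word_map f j v ` shifted_limit_set X I f k) \<noteq> {}}"

definition nerve_subcomplex ::
    "'a set \<Rightarrow> (nat \<Rightarrow> 'i set) \<Rightarrow> (nat \<Rightarrow> 'i \<Rightarrow> 'a \<Rightarrow> 'a) \<Rightarrow> nat \<Rightarrow> nat \<Rightarrow> nat \<Rightarrow> 'i list set set" where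
  "nerve_subcomplex X I f j k l =
     (\<Union>u\<in>words I j k. (\<lambda>S. (\<lambda>v. u @ v) ` S) ` nerve X I f k l)"


section \<open>Chain complexes of abelian groups\<close>

text \<open>
  A chain complex is given by groups \<open>C q\<close> and maps \<open>d q\<close> from \<open>C q\<close> to \<open>C (q - 1)\<close>, \<open>q\<close> an integer.
\<close>

definition cycles :: "(int \<Rightarrow> 'c monoid) \<Rightarrow> (int \<Rightarrow> 'c \<Rightarrow> 'c) \<Rightarrow> int \<Rightarrow> 'c set" where
  "cycles C d q = kernel (C q) (C (q - 1)) (d q)"

definition boundaries :: "(int \<Rightarrow> 'c monoid) \<Rightarrow> (int \<Rightarrow> 'c \<Rightarrow> 'c) \<Rightarrow> int \<Rightarrow> 'c set" where
  "boundaries C d q = d (q + 1) ` carrier (C (q + 1))"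

definition homology :: "(int \<Rightarrow> 'c monoid) \<Rightarrow> (int \<Rightarrow> 'c \<Rightarrow> 'c) \<Rightarrow> int \<Rightarrow> 'c set monoid" where
  "homology C d q = (C q)\<lparr>carrier := cycles C d q\<rparr> Mod boundaries C d q"

text \<open>
  Maps out of a quotient group are given on a coset by the common value at its representatives.
  The next map sends the class of \<open>z\<close> to the class of \<open>h q z\<close> in the homology of \<open>(C', d')\<close>.
\<close>

definition homology_induced ::
    "(int \<Rightarrow> 'b monoid) \<Rightarrow> (int \<Rightarrow> 'b \<Rightarrow> 'b) \<Rightarrow> (int \<Rightarrow> 'c \<Rightarrow> 'b) \<Rightarrow> int \<Rightarrow> 'c set \<Rightarrow> 'b set" where
  "homology_induced C' d' h q A = the_elem ((\<lambda>z. boundaries C' d' q #>\<^bsub>C' q\<^esub> h q z) ` A)"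

definition quotient_chain ::
    "(int \<Rightarrow> 'c monoid) \<Rightarrow> (int \<Rightarrow> 'c monoid) \<Rightarrow> int \<Rightarrow> 'c set monoid" where
  "quotient_chain C D q = C q Mod carrier (D q)"

definition quotient_proj ::
    "(int \<Rightarrow> 'c monoid) \<Rightarrow> (int \<Rightarrow> 'c monoid) \<Rightarrow> int \<Rightarrow> 'c \<Rightarrow> 'c set" where
  "quotient_proj C D q c = carrier (D q) #>\<^bsub>C q\<^esub> c"

definition quotient_boundary ::
    "(int \<Rightarrow> 'c monoid) \<Rightarrow> (int \<Rightarrow> 'c monoid) \<Rightarrow> (int \<Rightarrow> 'c \<Rightarrow> 'c) \<Rightarrow> int \<Rightarrow> 'c set \<Rightarrow> 'c set" where
  "quotient_boundary C D d q A = the_elem ((\<lambda>c. quotient_proj C D (q - 1) (d q c)) ` A)"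

text \<open>
  The connecting map sends the homology class of a relative cycle \<open>c + D q\<close> to the class of \<open>d q c\<close>.
\<close>

definition connecting_map ::
    "(int \<Rightarrow> 'c monoid) \<Rightarrow> (int \<Rightarrow> 'c monoid) \<Rightarrow> (int \<Rightarrow> 'c \<Rightarrow> 'c) \<Rightarrow> int \<Rightarrow> 'c set set \<Rightarrow> 'c set" where
  "connecting_map C D d q A =
     the_elem ((\<lambda>c. boundaries D d (q - 1) #>\<^bsub>D (q - 1)\<^esub> d q c) `
               {c \<in> carrier (C q). quotient_proj C D q c \<in> A})"

definition exact_at ::
    "'b monoid \<Rightarrow> ('b \<Rightarrow> 'c) \<Rightarrow> 'c monoid \<Rightarrow> ('c \<Rightarrow> 'e) \<Rightarrow> 'e monoid \<Rightarrow> bool" where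
  "exact_at G g H h K \<longleftrightarrow> group_hom G H g \<and> group_hom H K h \<and> g ` carrier G = kernel H K h"


section \<open>Simplicial homology\<close>

definition ordered_simplices :: "'v set set \<Rightarrow> int \<Rightarrow> 'v list set" where
  "ordered_simplices K q = {xs. distinct xs \<and> set xs \<in> K \<and> int (length xs) = q + 1}"

text \<open>
  An oriented \<open>q\<close>-chain is a finitely supported integer function on the ordered \<open>q\<close>-simplices that
  is multiplied by the sign of the permutation when the vertices are reordered. For \<open>q < 0\<close> the
  chain group is trivial, since the empty set is not a simplex.
\<close>

definition simplicial_chains :: "'v set set \<Rightarrow> int \<Rightarrow> ('v list \<Rightarrow>\<^sub>0 int) monoid" where
  "simplicial_chains K q =
     (free_Abelian_group (ordered_simplices K q))
       \<lparr>carrier := {c. Poly_Mapping.keys c \<subseteq> ordered_simplices K q \<and>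
          (\<forall>xs p. p permutes {..<length xs} \<longrightarrow>
             Poly_Mapping.lookup c (permute_list p xs) = sign p * Poly_Mapping.lookup c xs)}\<rparr>"

text \<open>
  The oriented simplex \<open>[x\<^sub>0, \<dots>, x\<^sub>q]\<close> as a chain: \<open>1\<close> on the even and \<open>-1\<close> on the odd
  reorderings of its vertices.
\<close>

definition oriented_simplex :: "'v list \<Rightarrow> 'v list \<Rightarrow>\<^sub>0 int" where
  "oriented_simplex xs =
     (\<Sum>p | p permutes {..<length xs}. frag_cmul (sign p) (frag_of (permute_list p xs)))"

text \<open>
  The coefficient of \<open>\<partial>c\<close> at \<open>ys\<close> is the sum of the coefficients of \<open>c\<close> at \<open>w # ys\<close> over all \<open>w\<close>.
  On oriented simplices this is the usual alternating sum of faces, see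
  \<open>simplicial_boundary_oriented_simplex\<close> below. The complex is not augmented.
\<close>

definition simplicial_boundary :: "int \<Rightarrow> ('v list \<Rightarrow>\<^sub>0 int) \<Rightarrow> ('v list \<Rightarrow>\<^sub>0 int)" where
  "simplicial_boundary q c = (if q \<le> 0 then 0 else frag_extend (\<lambda>xs. frag_of (tl xs)) c)"

lemma oriented_simplex_permute:
  assumes p: "p permutes {..<length xs}"
  shows "oriented_simplex (permute_list p xs) = frag_cmul (sign p) (oriented_simplex xs)"
proof -
  let ?S = "{..<length xs}"
  have perm: "permutation r" if "r permutes ?S" for r
    using that by (auto simp: permutation_permutes)
  have "oriented_simplex xs =
      (\<Sum>r | r permutes ?S. frag_cmul (sign (p \<circ> r)) (frag_of (permute_list (p \<circ> r) xs)))"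
    unfolding oriented_simplex_def by (rule setum_permutations_compose_left[OF p])
  also have "\<dots> = (\<Sum>r | r permutes ?S.
      frag_cmul (sign p) (frag_cmul (sign r) (frag_of (permute_list r (permute_list p xs)))))"
    by (rule sum.cong) (auto simp: sign_compose perm p permute_list_compose)
  also have "\<dots> = frag_cmul (sign p) (oriented_simplex (permute_list p xs))"
    by (simp add: oriented_simplex_def frag_cmul_sum)
  finally show ?thesis
    by simp
qed

lemma oriented_simplex_move_to_front:
  "oriented_simplex (ys @ x # zs) = frag_cmul ((-1) ^ length ys) (oriented_simplex (x # ys @ zs))"
proof (induction ys arbitrary: zs rule: rev_induct)
  case Nil
  then show ?case by simp
next
  case (snoc y ys)
  let ?t = "Transposition.transpose (length ys) (Suc (length ys))"
  have t: "?t permutes {..<length (ys @ x # y # zs)}"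
    by (rule permutes_swap_id) auto
  have "permute_list ?t (ys @ x # y # zs) = ys @ y # x # zs"
    by (rule nth_equalityI)
       (auto simp: permute_list_nth[OF t] Transposition.transpose_def nth_append nth_Cons
             split: nat.splits)
  then have "oriented_simplex (ys @ y # x # zs) = frag_cmul (-1) (oriented_simplex (ys @ x # y # zs))"
    using oriented_simplex_permute[OF t] by (simp add: sign_swap_id)
  then show ?case
    using snoc.IH[of "y # zs"] by simp
qed

lemma simplicial_boundary_oriented_simplex:
  assumes "length xs = nat q + 1" and "q > 0"
  shows "simplicial_boundary q (oriented_simplex xs) =
    (\<Sum>i\<le>nat q. frag_cmul ((-1) ^ i) (oriented_simplex (take i xs @ drop (Suc i) xs)))"
proof -
  define m where "m = nat q"
  have len: "length xs = Suc m" using assms by (simp add: m_def)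
  have ins: "{..<Suc m} = insert 0 (Suc ` {..<m})"
    by (auto simp: image_iff less_Suc_eq_0_disj)
  let ?F = "\<lambda>p. frag_cmul (sign p) (frag_of (tl (permute_list p xs)))"
  have face: "(\<Sum>r | r permutes Suc ` {..<m}. ?F (Transposition.transpose 0 b \<circ> r)) =
      frag_cmul ((-1) ^ b) (oriented_simplex (take b xs @ drop (Suc b) xs))"
    if b: "b \<le> m" for b
  proof -
    let ?t = "Transposition.transpose 0 b"
    define ys where "ys = permute_list ?t xs"
    have leny: "length ys = Suc m" by (simp add: ys_def len)
    have t: "?t permutes {..<length xs}"
      using b by (intro permutes_swap_id) (auto simp: len)
    have bij: "bij_betw (map_permutation {..<m} Suc) {r. r permutes {..<m}}
        {r. r permutes Suc ` {..<m}}"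
    proof -
      have "bij_betw Suc {..<m} (Suc ` {..<m})"
        by (simp add: bij_betw_def)
      from bij_betw_permutations[OF this] show ?thesis
        by (rule bij_betw_cong[THEN iffD1, rotated])
           (auto simp: map_permutation_def restrict_id_def fun_eq_iff)
    qed
    have summand: "?F (?t \<circ> map_permutation {..<m} Suc r) =
        frag_cmul (sign ?t) (frag_cmul (sign r) (frag_of (permute_list r (tl ys))))"
      if r: "r permutes {..<m}" for r
    proof -
      let ?r = "map_permutation {..<m} Suc r"
      have r1: "?r permutes Suc ` {..<m}"
        using r by (intro map_permutation_permutes) (auto simp: bij_betw_def)
      then have r2: "?r permutes {..<length xs}"
        by (rule permutes_subset) (auto simp: len)
      have r0: "?r (Suc n) = Suc (r n)" if "n < m" for n
        using that r by (subst map_permutation_apply) auto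
      have rn: "r n < m" if "n < m" for n
        using permutes_in_image[OF r, of n] that by simp
      have "tl (permute_list ?r ys) = permute_list r (tl ys)"
      proof (rule nth_equalityI)
        show "length (tl (permute_list ?r ys)) = length (permute_list r (tl ys))"
          by simp
        fix n assume "n < length (tl (permute_list ?r ys))"
        then have n: "n < m" by (simp add: leny)
        show "tl (permute_list ?r ys) ! n = permute_list r (tl ys) ! n"
          using n r r2 by (simp add: nth_tl leny len permute_list_nth r0 rn)
      qed
      moreover have "permute_list (?t \<circ> ?r) xs = permute_list ?r ys"
        using r2 by (simp add: ys_def permute_list_compose)
      moreover have "sign (?t \<circ> ?r) = sign ?t * sign r"
      proof -
        have "permutation ?t" "permutation ?r"
          using t r1 by (auto intro: permutes_imp_permutation[rotated])
        then show ?thesis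
          using r by (simp add: sign_compose sign_map_permutation)
      qed
      ultimately show ?thesis by simp
    qed
    have "(\<Sum>r | r permutes Suc ` {..<m}. ?F (?t \<circ> r)) =
        (\<Sum>r | r permutes {..<m}. ?F (?t \<circ> map_permutation {..<m} Suc r))"
      by (rule sum.reindex_bij_betw[OF bij, symmetric])
    also have "\<dots> = (\<Sum>r | r permutes {..<m}.
        frag_cmul (sign ?t) (frag_cmul (sign r) (frag_of (permute_list r (tl ys)))))"
      by (rule sum.cong) (use summand in auto)
    also have "\<dots> = frag_cmul (sign ?t) (oriented_simplex (tl ys))"
      by (simp add: oriented_simplex_def frag_cmul_sum leny)
    also have "\<dots> = frag_cmul ((-1) ^ b) (oriented_simplex (take b xs @ drop (Suc b) xs))"
    proof (cases b)
      case 0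
      then show ?thesis by (simp add: ys_def drop_Suc)
    next
      case (Suc a)
      obtain x xs' where xs: "xs = x # xs'" using len by (cases xs) auto
      have a: "a < length xs'" using b Suc len xs by simp
      have "tl ys = take a xs' @ x # drop (Suc a) xs'"
        using a t Suc
        by (intro nth_equalityI)
           (auto simp: ys_def xs nth_tl permute_list_nth Transposition.transpose_def nth_append
              nth_Cons' min_def)
      then show ?thesis
        using a Suc by (simp add: xs sign_swap_id oriented_simplex_move_to_front)
    qed
    finally show ?thesis .
  qed
  have "simplicial_boundary q (oriented_simplex xs) = (\<Sum>p | p permutes {..<Suc m}. ?F p)"
    using assms(2)
    by (simp add: simplicial_boundary_def oriented_simplex_def len frag_extend_sum
          finite_permutations frag_extend_cmul)
  also have "\<dots> = (\<Sum>b\<in>{..<Suc m}. \<Sum>r | r permutes Suc ` {..<m}. ?F (Transposition.transpose 0 b \<circ> r))"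
    unfolding ins by (rule sum_over_permutations_insert) auto
  also have "\<dots> = (\<Sum>i\<le>m. frag_cmul ((-1) ^ i) (oriented_simplex (take i xs @ drop (Suc i) xs)))"
    by (rule sum.cong) (use face in auto)
  finally show ?thesis by (simp add: m_def)
qed

definition simplicial_homology :: "'v set set \<Rightarrow> int \<Rightarrow> ('v list \<Rightarrow>\<^sub>0 int) set monoid" where
  "simplicial_homology K = homology (simplicial_chains K) simplicial_boundary"

definition relative_simplicial_homology ::
    "'v set set \<Rightarrow> 'v set set \<Rightarrow> int \<Rightarrow> ('v list \<Rightarrow>\<^sub>0 int) set set monoid" where
  "relative_simplicial_homology K L =
     homology (quotient_chain (simplicial_chains K) (simplicial_chains L))
       (quotient_boundary (simplicial_chains K) (simplicial_chains L) simplicial_boundary)"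

text \<open>
  For a subcomplex \<open>L\<close> of \<open>K\<close> the chains of \<open>L\<close> are chains of \<open>K\<close>, so on chains the inclusion
  is the identity.
\<close>

definition homology_inclusion ::
    "'v set set \<Rightarrow> int \<Rightarrow> ('v list \<Rightarrow>\<^sub>0 int) set \<Rightarrow> ('v list \<Rightarrow>\<^sub>0 int) set" where
  "homology_inclusion K = homology_induced (simplicial_chains K) simplicial_boundary (\<lambda>q c. c)"

definition homology_projection ::
    "'v set set \<Rightarrow> 'v set set \<Rightarrow> int \<Rightarrow> ('v list \<Rightarrow>\<^sub>0 int) set \<Rightarrow> ('v list \<Rightarrow>\<^sub>0 int) set set" where
  "homology_projection K L =
     homology_induced (quotient_chain (simplicial_chains K) (simplicial_chains L))
       (quotient_boundary (simplicial_chains K) (simplicial_chains L) simplicial_boundary)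
       (quotient_proj (simplicial_chains K) (simplicial_chains L))"

definition homology_connecting ::
    "'v set set \<Rightarrow> 'v set set \<Rightarrow> int \<Rightarrow> ('v list \<Rightarrow>\<^sub>0 int) set set \<Rightarrow> ('v list \<Rightarrow>\<^sub>0 int) set" where
  "homology_connecting K L =
     connecting_map (simplicial_chains K) (simplicial_chains L) simplicial_boundary"

end

theory Submission
  imports Defs
begin

text \<open>
  The sequence is the long exact homology sequence of the short exact sequence of chain complexes
  \<open>0 \<rightarrow> C(M) \<rightarrow> C(N) \<rightarrow> C(N) / C(M) \<rightarrow> 0\<close>. Three things make it available.

  Algebra: for a subcomplex \<open>D\<close> of a chain complex \<open>(C, d)\<close> of abelian groups, every map in the
  sequence is described by representatives: the inclusion sends the class of \<open>z\<close> to the class of \<open>z\<close>,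
  the projection to the class of \<open>z + D\<close>, and the connecting map sends the class of \<open>c + D\<close>, where
  \<open>d c\<close> lies in \<open>D\<close>, to the class of \<open>d c\<close> (\<open>connecting_map_class\<close>). Given these rules, which show
  that the values do not depend on the representatives, exactness is a chase of elements
  (\<open>exact_at_complex\<close>, \<open>exact_at_quotient\<close>, \<open>exact_at_subcomplex\<close>).

  Simplicial chains: the boundary of an alternating chain is alternating, because a permutation of
  \<open>ys\<close> extends to \<open>w # ys\<close> with the same sign, and the boundary squares to zero, because removing
  the first two vertices of an ordered simplex is unaffected by swapping them while an alternating
  chain changes sign (\<open>frag_extend_alternating_eq_0\<close>). Only closure of the complex under taking
  faces is used.

  Geometry: \<open>M\<close> is a subcomplex of \<open>N\<close>, because a common point \<open>x\<close> of the sets \<open>f\<^sub>v(J\<^sub>l)\<close> gives the common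
  point \<open>f\<^sub>u(x)\<close> of the sets \<open>f\<^sub>u\<^sub>v(J\<^sub>l)\<close> (\<open>nerve_subcomplex_subset_nerve\<close>).
\<close>

section \<open>Quotients of commutative groups\<close>

context comm_group
begin

lemma coset_eq_iff:
  assumes "subgroup H G" "x \<in> carrier G" "y \<in> carrier G"
  shows "H #> x = H #> y \<longleftrightarrow> x \<otimes> inv y \<in> H"
  using assms is_group
  by (metis rcos_self repr_independence subgroup.rcos_module)

lemma coset_eq_self_iff:
  assumes "subgroup H G" "x \<in> carrier G"
  shows "H #> x = H \<longleftrightarrow> x \<in> H"
  using assms coset_join1 coset_join2 by blast

lemma mult_inv_mult_inv:
  assumes "x \<in> carrier G" "y \<in> carrier G"
  shows "x \<otimes> inv (x \<otimes> inv y) = y" and "(x \<otimes> inv y) \<otimes> inv x = inv y"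
  using assms by (simp add: inv_mult flip: m_assoc, simp add: m_comm[of x "inv y"] m_assoc)

lemma comm_group_subgroup:
  assumes "subgroup H G"
  shows "comm_group (G\<lparr>carrier := H\<rparr>)"
proof (rule group.group_comm_groupI)
  show "group (G\<lparr>carrier := H\<rparr>)"
    by (rule subgroup_imp_group[OF assms])
qed (auto intro: m_comm subgroup.mem_carrier[OF assms])

lemma comm_group_FactGroup:
  assumes "subgroup H G"
  shows "comm_group (G Mod H)"
  using assms by (simp add: abelian_FactGroup)

lemma coset_hom:
  assumes "subgroup H G"
  shows "(\<lambda>x. H #> x) \<in> hom G (G Mod H)"
  using assms by (simp add: normal.r_coset_hom_Mod subgroup_imp_normal)

text \<open>A map that is constant on a coset has as its common value the one at any representative.\<close>

lemma the_elem_image_coset: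
  assumes H: "subgroup H G" and x: "x \<in> carrier G"
    and \<phi>: "\<And>h. h \<in> H \<Longrightarrow> \<phi> (h \<otimes> x) = \<phi> x"
  shows "the_elem (\<phi> ` (H #> x)) = \<phi> x"
proof -
  have "\<phi> ` (H #> x) = {\<phi> x}"
    using \<phi> rcos_self[OF x H] by (fastforce simp: r_coset_def)
  then show ?thesis by simp
qed

end

section \<open>Homology of a chain complex\<close>

text \<open>
  The class of a cycle \<open>z\<close>. The coset is formed in the whole chain group, which gives the same set as
  forming it in the group of cycles.
\<close>

definition homology_class ::
    "(int \<Rightarrow> 'c monoid) \<Rightarrow> (int \<Rightarrow> 'c \<Rightarrow> 'c) \<Rightarrow> int \<Rightarrow> 'c \<Rightarrow> 'c set" where
  "homology_class C d q z = boundaries C d q #>\<^bsub>C q\<^esub> z"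

text \<open>
  A chain complex of abelian groups, written multiplicatively and indexed by the integers.
\<close>

locale chain_complex =
  fixes C :: "int \<Rightarrow> 'c monoid" and d :: "int \<Rightarrow> 'c \<Rightarrow> 'c"
  assumes comm_group_chain: "comm_group (C q)"
    and d_hom: "d q \<in> hom (C q) (C (q - 1))"
    and d_d: "c \<in> carrier (C (q + 1)) \<Longrightarrow> d q (d (q + 1) c) = \<one>\<^bsub>C (q - 1)\<^esub>"
begin

lemma group_chain: "group (C q)"
  using comm_group_chain comm_group.axioms(2) by blast

lemma group_hom_d: "group_hom (C q) (C (q - 1)) (d q)"
  by (simp add: group_hom_def group_hom_axioms_def group_chain d_hom)

lemma d_closed: "c \<in> carrier (C q) \<Longrightarrow> d q c \<in> carrier (C (q - 1))"
  using d_hom by (auto simp: hom_def)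

lemma cycles_iff: "z \<in> cycles C d q \<longleftrightarrow> z \<in> carrier (C q) \<and> d q z = \<one>\<^bsub>C (q - 1)\<^esub>"
  by (simp add: cycles_def kernel_def)

lemma cycles_closed: "z \<in> cycles C d q \<Longrightarrow> z \<in> carrier (C q)"
  by (simp add: cycles_iff)

lemma subgroup_cycles: "subgroup (cycles C d q) (C q)"
  unfolding cycles_def by (rule group_hom.subgroup_kernel[OF group_hom_d])

lemma boundaries_subset_cycles: "boundaries C d q \<subseteq> cycles C d q"
  using d_closed[of _ "q + 1"] by (auto simp: boundaries_def cycles_iff d_d)

lemma subgroup_boundaries: "subgroup (boundaries C d q) (C q)"
  using group_hom.img_is_subgroup[OF group_hom_d[of "q + 1"]]
  by (simp add: boundaries_def)

lemma d_in_cycles: "c \<in> carrier (C q) \<Longrightarrow> d q c \<in> cycles C d (q - 1)"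
  using boundaries_subset_cycles[of "q - 1"] by (auto simp: boundaries_def)

lemma comm_group_cycles: "comm_group ((C q)\<lparr>carrier := cycles C d q\<rparr>)"
  by (rule comm_group.comm_group_subgroup[OF comm_group_chain subgroup_cycles])

lemma subgroup_boundaries_cycles:
  "subgroup (boundaries C d q) ((C q)\<lparr>carrier := cycles C d q\<rparr>)"
  by (simp add: boundaries_subset_cycles group.subgroup_incl group_chain subgroup_boundaries
      subgroup_cycles)

lemma comm_group_homology: "comm_group (homology C d q)"
  unfolding homology_def
  by (rule comm_group.comm_group_FactGroup[OF comm_group_cycles subgroup_boundaries_cycles])

lemma group_homology: "group (homology C d q)"
  using comm_group_homology comm_group.axioms(2) by blast

lemma carrier_homology: "carrier (homology C d q) = homology_class C d q ` cycles C d q"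
  by (simp add: homology_def carrier_FactGroup homology_class_def r_coset_def)

lemma homology_class_hom:
  "homology_class C d q \<in> hom ((C q)\<lparr>carrier := cycles C d q\<rparr>) (homology C d q)"
proof -
  have "homology_class C d q = (\<lambda>z. boundaries C d q #>\<^bsub>(C q)\<lparr>carrier := cycles C d q\<rparr>\<^esub> z)"
    by (simp add: fun_eq_iff homology_class_def r_coset_def)
  then show ?thesis
    using comm_group.coset_hom[OF comm_group_cycles subgroup_boundaries_cycles]
    by (simp add: homology_def)
qed

lemma homology_class_mult:
  assumes "z \<in> cycles C d q" "w \<in> cycles C d q"
  shows "homology_class C d q (z \<otimes>\<^bsub>C q\<^esub> w) =
    homology_class C d q z \<otimes>\<^bsub>homology C d q\<^esub> homology_class C d q w"
  using hom_mult[OF homology_class_hom, of z q w] assms by simp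

lemma homology_class_closed:
  "z \<in> cycles C d q \<Longrightarrow> homology_class C d q z \<in> carrier (homology C d q)"
  by (simp add: carrier_homology)

lemma homology_class_eq_iff:
  assumes "z \<in> carrier (C q)" "w \<in> carrier (C q)"
  shows "homology_class C d q z = homology_class C d q w \<longleftrightarrow>
    z \<otimes>\<^bsub>C q\<^esub> inv\<^bsub>C q\<^esub> w \<in> boundaries C d q"
  unfolding homology_class_def
  by (rule comm_group.coset_eq_iff[OF comm_group_chain subgroup_boundaries assms])

lemma homology_class_eq_one_iff:
  assumes "z \<in> carrier (C q)"
  shows "homology_class C d q z = \<one>\<^bsub>homology C d q\<^esub> \<longleftrightarrow> z \<in> boundaries C d q"
  using comm_group.coset_eq_self_iff[OF comm_group_chain subgroup_boundaries assms]
  by (simp add: homology_class_def homology_def)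

text \<open>A map on homology is a homomorphism as soon as it is one on representing cycles.\<close>

lemma group_hom_homologyI:
  assumes K: "group K"
    and \<phi>: "\<phi> \<in> hom ((C q)\<lparr>carrier := cycles C d q\<rparr>) K"
    and g: "\<And>z. z \<in> cycles C d q \<Longrightarrow> g (homology_class C d q z) = \<phi> z"
  shows "group_hom (homology C d q) K g"
proof -
  interpret Z: group "(C q)\<lparr>carrier := cycles C d q\<rparr>"
    using comm_group_cycles comm_group.axioms(2) by blast
  have "g \<in> hom (homology C d q) K"
  proof (rule homI)
    fix A assume "A \<in> carrier (homology C d q)"
    then show "g A \<in> carrier K"
      using g hom_in_carrier[OF \<phi>] by (auto simp: carrier_homology)
  next
    fix A B assume "A \<in> carrier (homology C d q)" "B \<in> carrier (homology C d q)"
    then obtain z w where z: "z \<in> cycles C d q" "A = homology_class C d q z"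
      and w: "w \<in> cycles C d q" "B = homology_class C d q w"
      by (auto simp: carrier_homology)
    then show "g (A \<otimes>\<^bsub>homology C d q\<^esub> B) = g A \<otimes>\<^bsub>K\<^esub> g B"
      using hom_mult[OF \<phi>, of z w] Z.m_closed[of z w]
      by (simp add: g homology_class_mult[symmetric])
  qed
  then show ?thesis
    by (simp add: group_hom_def group_hom_axioms_def K group_homology)
qed

end

text \<open>A chain map, that is, a family of homomorphisms that commutes with the boundary maps.\<close>

locale chain_map = source: chain_complex C d + target: chain_complex C' d'
  for C :: "int \<Rightarrow> 'c monoid" and d and C' :: "int \<Rightarrow> 'e monoid" and d' +
  fixes h :: "int \<Rightarrow> 'c \<Rightarrow> 'e"
  assumes h_hom: "h q \<in> hom (C q) (C' q)"
    and d_h: "c \<in> carrier (C q) \<Longrightarrow> d' q (h q c) = h (q - 1) (d q c)"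
begin

lemma h_closed: "c \<in> carrier (C q) \<Longrightarrow> h q c \<in> carrier (C' q)"
  by (rule hom_in_carrier[OF h_hom])

lemma h_one: "h q \<one>\<^bsub>C q\<^esub> = \<one>\<^bsub>C' q\<^esub>"
  using hom_one[OF h_hom source.group_chain target.group_chain] .

lemma h_cycles: "z \<in> cycles C d q \<Longrightarrow> h q z \<in> cycles C' d' q"
  by (simp add: source.cycles_iff target.cycles_iff h_closed d_h h_one)

lemma h_boundaries: "b \<in> boundaries C d q \<Longrightarrow> h q b \<in> boundaries C' d' q"
proof -
  assume "b \<in> boundaries C d q"
  then obtain c where c: "c \<in> carrier (C (q + 1))" and b: "b = d (q + 1) c"
    by (auto simp: boundaries_def)
  have "h q b = d' (q + 1) (h (q + 1) c)"
    using d_h[OF c] by (simp add: b)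
  then show "h q b \<in> boundaries C' d' q"
    using h_closed[OF c] by (simp add: boundaries_def)
qed

lemma homology_induced_class:
  assumes z: "z \<in> cycles C d q"
  shows "homology_induced C' d' h q (homology_class C d q z) = homology_class C' d' q (h q z)"
proof -
  interpret G: comm_group "C q" by (rule source.comm_group_chain)
  interpret G': comm_group "C' q" by (rule target.comm_group_chain)
  have zc: "z \<in> carrier (C q)" by (rule source.cycles_closed[OF z])
  have "homology_class C' d' q (h q (b \<otimes>\<^bsub>C q\<^esub> z)) = homology_class C' d' q (h q z)"
    if b: "b \<in> boundaries C d q" for b
  proof -
    have bc: "b \<in> carrier (C q)"
      by (rule subgroup.mem_carrier[OF source.subgroup_boundaries b])
    have "h q (b \<otimes>\<^bsub>C q\<^esub> z) \<otimes>\<^bsub>C' q\<^esub> inv\<^bsub>C' q\<^esub> (h q z) = h q b"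
      using hom_mult[OF h_hom bc zc] h_closed[OF bc] h_closed[OF zc]
      by (simp add: G'.m_assoc)
    then show ?thesis
      using h_boundaries[OF b] bc zc
      by (subst target.homology_class_eq_iff) (auto intro: h_closed)
  qed
  then show ?thesis
    using G.the_elem_image_coset[OF source.subgroup_boundaries zc,
        where \<phi> = "\<lambda>z. homology_class C' d' q (h q z)"]
    by (simp add: homology_induced_def homology_class_def)
qed

lemma group_hom_homology_induced:
  "group_hom (homology C d q) (homology C' d' q) (homology_induced C' d' h q)"
proof (rule source.group_hom_homologyI[OF target.group_homology])
  show "(\<lambda>z. homology_class C' d' q (h q z)) \<in>
      hom ((C q)\<lparr>carrier := cycles C d q\<rparr>) (homology C' d' q)"
    by (rule homI)
       (simp_all add: target.homology_class_closed h_cycles hom_mult[OF h_hom] source.cycles_closed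
          target.homology_class_mult)
qed (rule homology_induced_class)

end

section \<open>The long exact sequence of a subcomplex\<close>

text \<open>
  A subcomplex is given by groups \<open>D q\<close> that inherit their operation and unit from \<open>C q\<close>. The boundary
  maps of \<open>C\<close> serve for \<open>D\<close> as well, and \<open>Q\<close> below is the quotient complex.
\<close>

locale chain_subcomplex = chain_complex +
  fixes D :: "int \<Rightarrow> 'a monoid"
  assumes subgroup_D: "subgroup (carrier (D q)) (C q)"
    and D_eq: "(C q)\<lparr>carrier := carrier (D q)\<rparr> = D q"
    and d_D: "c \<in> carrier (D q) \<Longrightarrow> d q c \<in> carrier (D (q - 1))"
begin

abbreviation Q where "Q \<equiv> quotient_chain C D"
abbreviation \<pi> where "\<pi> \<equiv> quotient_proj C D"
abbreviation dQ where "dQ \<equiv> quotient_boundary C D d"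

lemma mult_D: "x \<otimes>\<^bsub>D q\<^esub> y = x \<otimes>\<^bsub>C q\<^esub> y"
  and one_D [simp]: "\<one>\<^bsub>D q\<^esub> = \<one>\<^bsub>C q\<^esub>"
proof -
  have "monoid.mult (D q) = monoid.mult ((C q)\<lparr>carrier := carrier (D q)\<rparr>)"
    and "\<one>\<^bsub>D q\<^esub> = \<one>\<^bsub>(C q)\<lparr>carrier := carrier (D q)\<rparr>\<^esub>"
    by (simp_all only: D_eq)
  then show "x \<otimes>\<^bsub>D q\<^esub> y = x \<otimes>\<^bsub>C q\<^esub> y" and "\<one>\<^bsub>D q\<^esub> = \<one>\<^bsub>C q\<^esub>"
    by simp_all
qed

lemma D_closed: "c \<in> carrier (D q) \<Longrightarrow> c \<in> carrier (C q)"
  by (rule subgroup.mem_carrier[OF subgroup_D])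

sublocale D: chain_complex D d
proof (rule chain_complex.intro)
  show "comm_group (D q)" for q
    using comm_group.comm_group_subgroup[OF comm_group_chain subgroup_D, of q]
    by (simp add: D_eq)
  show "d q \<in> hom (D q) (D (q - 1))" for q
    by (rule homI) (simp_all add: mult_D hom_mult[OF d_hom] d_D D_closed)
  show "d q (d (q + 1) c) = \<one>\<^bsub>D (q - 1)\<^esub>" if "c \<in> carrier (D (q + 1))" for q c
    using that by (simp add: d_d D_closed)
qed

sublocale inclusion: chain_map D d C d "\<lambda>q c. c"
  by unfold_locales (auto intro!: homI D_closed simp: mult_D)

lemma comm_group_Q: "comm_group (Q q)"
  unfolding quotient_chain_def
  by (rule comm_group.comm_group_FactGroup[OF comm_group_chain subgroup_D])

lemma proj_hom: "\<pi> q \<in> hom (C q) (Q q)"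
  using comm_group.coset_hom[OF comm_group_chain subgroup_D, of q]
  by (simp add: quotient_chain_def quotient_proj_def[abs_def])

lemma carrier_Q: "carrier (Q q) = \<pi> q ` carrier (C q)"
  by (simp add: quotient_chain_def quotient_proj_def carrier_FactGroup)

lemma proj_eq_iff:
  assumes "x \<in> carrier (C q)" "y \<in> carrier (C q)"
  shows "\<pi> q x = \<pi> q y \<longleftrightarrow> x \<otimes>\<^bsub>C q\<^esub> inv\<^bsub>C q\<^esub> y \<in> carrier (D q)"
  unfolding quotient_proj_def
  by (rule comm_group.coset_eq_iff[OF comm_group_chain subgroup_D assms])

lemma proj_eq_one_iff:
  assumes "x \<in> carrier (C q)"
  shows "\<pi> q x = \<one>\<^bsub>Q q\<^esub> \<longleftrightarrow> x \<in> carrier (D q)"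
  using comm_group.coset_eq_self_iff[OF comm_group_chain subgroup_D assms]
  by (simp add: quotient_proj_def quotient_chain_def)

lemma quotient_boundary_proj:
  assumes c: "c \<in> carrier (C q)"
  shows "dQ q (\<pi> q c) = \<pi> (q - 1) (d q c)"
proof -
  interpret G: comm_group "C q" by (rule comm_group_chain)
  interpret G': comm_group "C (q - 1)" by (rule comm_group_chain)
  have "\<pi> (q - 1) (d q (e \<otimes>\<^bsub>C q\<^esub> c)) = \<pi> (q - 1) (d q c)" if e: "e \<in> carrier (D q)" for e
  proof -
    have "d q (e \<otimes>\<^bsub>C q\<^esub> c) \<otimes>\<^bsub>C (q - 1)\<^esub> inv\<^bsub>C (q - 1)\<^esub> (d q c) = d q e"
      using hom_mult[OF d_hom D_closed[OF e] c] d_closed[OF D_closed[OF e]] d_closed[OF c]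
      by (simp add: G'.m_assoc)
    then show ?thesis
      using c e by (subst proj_eq_iff) (auto intro: d_closed D_closed d_D)
  qed
  then show ?thesis
    using G.the_elem_image_coset[OF subgroup_D c, where \<phi> = "\<lambda>c. \<pi> (q - 1) (d q c)"]
    by (simp add: quotient_boundary_def quotient_proj_def)
qed

sublocale Q: chain_complex Q dQ
proof (rule chain_complex.intro)
  show "comm_group (Q q)" for q by (rule comm_group_Q)
  show "dQ q \<in> hom (Q q) (Q (q - 1))" for q
  proof (rule homI)
    fix A assume "A \<in> carrier (Q q)"
    then show "dQ q A \<in> carrier (Q (q - 1))"
      by (auto simp: carrier_Q quotient_boundary_proj d_closed)
  next
    fix A B assume "A \<in> carrier (Q q)" "B \<in> carrier (Q q)"
    then obtain x y where x: "x \<in> carrier (C q)" "A = \<pi> q x"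
      and y: "y \<in> carrier (C q)" "B = \<pi> q y"
      by (auto simp: carrier_Q)
    have xy: "x \<otimes>\<^bsub>C q\<^esub> y \<in> carrier (C q)"
      using x y by (simp add: group.is_monoid group_chain monoid.m_closed)
    have "A \<otimes>\<^bsub>Q q\<^esub> B = \<pi> q (x \<otimes>\<^bsub>C q\<^esub> y)"
      using x y by (simp add: hom_mult[OF proj_hom])
    then have "dQ q (A \<otimes>\<^bsub>Q q\<^esub> B) = \<pi> (q - 1) (d q (x \<otimes>\<^bsub>C q\<^esub> y))"
      by (simp add: quotient_boundary_proj[OF xy])
    also have "\<dots> = \<pi> (q - 1) (d q x) \<otimes>\<^bsub>Q (q - 1)\<^esub> \<pi> (q - 1) (d q y)"
      using x y by (simp add: hom_mult[OF d_hom] hom_mult[OF proj_hom] d_closed)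
    finally show "dQ q (A \<otimes>\<^bsub>Q q\<^esub> B) = dQ q A \<otimes>\<^bsub>Q (q - 1)\<^esub> dQ q B"
      using x y by (simp add: quotient_boundary_proj)
  qed
  show "dQ q (dQ (q + 1) A) = \<one>\<^bsub>Q (q - 1)\<^esub>" if "A \<in> carrier (Q (q + 1))" for q A
    using that d_closed[of _ "q + 1"] hom_one[OF proj_hom group_chain comm_group.axioms(2)[OF comm_group_Q]]
    by (auto simp: carrier_Q quotient_boundary_proj d_d)
qed

sublocale projection: chain_map C d Q dQ \<pi>
  by unfold_locales (simp_all add: proj_hom quotient_boundary_proj)

text \<open>The relative cycles are the cosets of the chains whose boundary lies in \<open>D\<close>.\<close>

lemma proj_cycle_iff:
  assumes "c \<in> carrier (C q)"
  shows "\<pi> q c \<in> cycles Q dQ q \<longleftrightarrow> d q c \<in> carrier (D (q - 1))"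
  using assms by (simp add: Q.cycles_iff carrier_Q quotient_boundary_proj proj_eq_one_iff d_closed)

lemma carrier_relative_homology:
  "carrier (homology Q dQ q) =
    (\<lambda>c. homology_class Q dQ q (\<pi> q c)) ` {c \<in> carrier (C q). d q c \<in> carrier (D (q - 1))}"
proof -
  have "cycles Q dQ q = \<pi> q ` {c \<in> carrier (C q). d q c \<in> carrier (D (q - 1))}"
    by (force simp: Q.cycles_iff carrier_Q quotient_boundary_proj proj_eq_one_iff d_closed)
  then show ?thesis
    by (simp add: Q.carrier_homology image_image)
qed

lemma d_in_cycles_D:
  assumes "c \<in> carrier (C q)" "d q c \<in> carrier (D (q - 1))"
  shows "d q c \<in> cycles D d (q - 1)"
  using assms d_in_cycles[of c q] by (simp add: cycles_iff D.cycles_iff)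

lemma proj_in_boundaries_iff:
  assumes c: "c \<in> carrier (C q)"
  shows "\<pi> q c \<in> boundaries Q dQ q \<longleftrightarrow>
    (\<exists>b\<in>carrier (C (q + 1)). c \<otimes>\<^bsub>C q\<^esub> inv\<^bsub>C q\<^esub> d (q + 1) b \<in> carrier (D q))"
proof -
  have "boundaries Q dQ q = (\<lambda>b. \<pi> q (d (q + 1) b)) ` carrier (C (q + 1))"
    using quotient_boundary_proj[of _ "q + 1"] by (simp add: boundaries_def carrier_Q image_image)
  moreover have "\<pi> q c = \<pi> q (d (q + 1) b) \<longleftrightarrow> c \<otimes>\<^bsub>C q\<^esub> inv\<^bsub>C q\<^esub> d (q + 1) b \<in> carrier (D q)"
    if "b \<in> carrier (C (q + 1))" for b
    using proj_eq_iff[OF c] d_closed[OF that] by simp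
  ultimately show ?thesis by (auto simp: image_iff)
qed

text \<open>
  The connecting map is well defined: in additive notation, if \<open>x + D\<close> and \<open>c + D\<close> are homologous, then
  \<open>x = e + d b + c\<close> with \<open>e\<close> in \<open>D\<close>, so \<open>d x\<close> and \<open>d c\<close> differ by the boundary \<open>d e\<close> of a chain of \<open>D\<close>.
\<close>

lemma connecting_map_class:
  assumes c: "c \<in> carrier (C q)" and dc: "d q c \<in> carrier (D (q - 1))"
  shows "connecting_map C D d q (homology_class Q dQ q (\<pi> q c)) =
    homology_class D d (q - 1) (d q c)"
proof -
  interpret G: comm_group "C q" by (rule comm_group_chain)
  interpret G': comm_group "C (q - 1)" by (rule comm_group_chain)
  interpret H': comm_group "D (q - 1)" by (rule D.comm_group_chain)
  interpret QG: comm_group "Q q" by (rule comm_group_Q)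
  let ?A = "homology_class Q dQ q (\<pi> q c)"
  have "homology_class D d (q - 1) (d q x) = homology_class D d (q - 1) (d q c)"
    if x: "x \<in> carrier (C q)" and xA: "\<pi> q x \<in> ?A" for x
  proof -
    obtain \<beta> where "\<beta> \<in> boundaries Q dQ q" and \<pi>x: "\<pi> q x = \<beta> \<otimes>\<^bsub>Q q\<^esub> \<pi> q c"
      using xA by (auto simp: homology_class_def r_coset_def)
    then obtain b where b: "b \<in> carrier (C (q + 1))" and \<beta>: "\<beta> = \<pi> q (d (q + 1) b)"
      using quotient_boundary_proj[of _ "q + 1"] by (auto simp: boundaries_def carrier_Q)
    have db: "d (q + 1) b \<in> carrier (C q)" using d_closed[OF b] by simp
    have "\<pi> q x = \<pi> q (d (q + 1) b \<otimes>\<^bsub>C q\<^esub> c)"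
      by (simp add: \<pi>x \<beta> hom_mult[OF proj_hom db c])
    then have e: "x \<otimes>\<^bsub>C q\<^esub> inv\<^bsub>C q\<^esub> (d (q + 1) b \<otimes>\<^bsub>C q\<^esub> c) \<in> carrier (D q)"
      (is "?e \<in> _")
      using proj_eq_iff[OF x, of "d (q + 1) b \<otimes>\<^bsub>C q\<^esub> c"] db c by simp
    have "x = ?e \<otimes>\<^bsub>C q\<^esub> (d (q + 1) b \<otimes>\<^bsub>C q\<^esub> c)"
      using x db c by (simp add: G.m_assoc)
    then have "d q x = d q ?e \<otimes>\<^bsub>C (q - 1)\<^esub> d q c"
      using hom_mult[OF d_hom D_closed[OF e], of "d (q + 1) b \<otimes>\<^bsub>C q\<^esub> c"]
        hom_mult[OF d_hom db c] db c d_closed[OF c]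
      by (simp add: d_d[OF b])
    moreover have "d q ?e \<in> boundaries D d (q - 1)"
      using e by (simp add: boundaries_def)
    ultimately show ?thesis
      using dc d_D[OF e]
      by (simp add: D.homology_class_eq_iff H'.m_assoc del: one_D flip: mult_D)
  qed
  then have "(\<lambda>x. homology_class D d (q - 1) (d q x)) ` {x \<in> carrier (C q). \<pi> q x \<in> ?A} \<subseteq>
      {homology_class D d (q - 1) (d q c)}"
    by (simp add: image_subset_iff)
  moreover have "\<pi> q c \<in> ?A"
    unfolding homology_class_def
    by (rule QG.rcos_self[OF projection.h_closed[OF c] Q.subgroup_boundaries])
  then have "homology_class D d (q - 1) (d q c) \<in>
      (\<lambda>x. homology_class D d (q - 1) (d q x)) ` {x \<in> carrier (C q). \<pi> q x \<in> ?A}"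
    by (intro imageI CollectI conjI c)
  ultimately have "(\<lambda>x. homology_class D d (q - 1) (d q x)) `
      {x \<in> carrier (C q). \<pi> q x \<in> ?A} = {homology_class D d (q - 1) (d q c)}"
    by (intro equalityI) simp_all
  then show ?thesis
    unfolding connecting_map_def homology_class_def[of D] by simp
qed

lemma group_hom_connecting_map:
  "group_hom (homology Q dQ q) (homology D d (q - 1)) (connecting_map C D d q)"
proof -
  have "connecting_map C D d q \<in> hom (homology Q dQ q) (homology D d (q - 1))"
  proof (rule homI)
    fix A assume "A \<in> carrier (homology Q dQ q)"
    then show "connecting_map C D d q A \<in> carrier (homology D d (q - 1))"
      by (auto simp: carrier_relative_homology connecting_map_class
          intro!: D.homology_class_closed d_in_cycles_D)
  next
    fix A B assume "A \<in> carrier (homology Q dQ q)" "B \<in> carrier (homology Q dQ q)"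
    then obtain x y where x: "x \<in> carrier (C q)" "d q x \<in> carrier (D (q - 1))"
        "A = homology_class Q dQ q (\<pi> q x)"
      and y: "y \<in> carrier (C q)" "d q y \<in> carrier (D (q - 1))"
        "B = homology_class Q dQ q (\<pi> q y)"
      by (auto simp: carrier_relative_homology)
    have xy: "x \<otimes>\<^bsub>C q\<^esub> y \<in> carrier (C q)"
      using x y by (simp add: group.is_monoid group_chain monoid.m_closed)
    have dxy: "d q (x \<otimes>\<^bsub>C q\<^esub> y) = d q x \<otimes>\<^bsub>D (q - 1)\<^esub> d q y"
      using x y by (simp add: hom_mult[OF d_hom] mult_D)
    then have dxy_D: "d q (x \<otimes>\<^bsub>C q\<^esub> y) \<in> carrier (D (q - 1))"
      using x y D.group_chain by (metis group.is_monoid monoid.m_closed)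
    have "A \<otimes>\<^bsub>homology Q dQ q\<^esub> B = homology_class Q dQ q (\<pi> q (x \<otimes>\<^bsub>C q\<^esub> y))"
      using x y hom_mult[OF proj_hom, of x q y]
      by (simp add: Q.homology_class_mult proj_cycle_iff)
    then show "connecting_map C D d q (A \<otimes>\<^bsub>homology Q dQ q\<^esub> B) =
        connecting_map C D d q A \<otimes>\<^bsub>homology D d (q - 1)\<^esub> connecting_map C D d q B"
      using x y connecting_map_class[OF xy dxy_D]
      by (simp add: connecting_map_class dxy d_in_cycles_D D.homology_class_mult)
  qed
  then show ?thesis
    by (simp add: group_hom_def group_hom_axioms_def Q.group_homology D.group_homology)
qed

lemma exact_at_complex:
  "exact_at (homology D d q) (homology_induced C d (\<lambda>q c. c) q) (homology C d q)
    (homology_induced Q dQ \<pi> q) (homology Q dQ q)"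
proof -
  interpret G: comm_group "C q" by (rule comm_group_chain)
  let ?i = "homology_induced C d (\<lambda>q c. c) q"
  let ?p = "homology_induced Q dQ \<pi> q"
  have "?i ` carrier (homology D d q) = kernel (homology C d q) (homology Q dQ q) ?p"
  proof (intro subset_antisym subsetI)
    fix A assume "A \<in> ?i ` carrier (homology D d q)"
    then obtain z where z: "z \<in> cycles D d q" and A: "A = homology_class C d q z"
      by (auto simp: D.carrier_homology inclusion.homology_induced_class)
    have zC: "z \<in> cycles C d q" by (rule inclusion.h_cycles[OF z])
    have "\<pi> q z = \<one>\<^bsub>Q q\<^esub>"
      using D.cycles_closed[OF z] by (simp add: proj_eq_one_iff D_closed)
    then have "\<pi> q z \<in> boundaries Q dQ q"
      using subgroup.one_closed[OF Q.subgroup_boundaries] by simp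
    then show "A \<in> kernel (homology C d q) (homology Q dQ q) ?p"
      using zC by (simp add: kernel_def A homology_class_closed projection.homology_induced_class
          Q.homology_class_eq_one_iff projection.h_closed cycles_closed)
  next
    fix A assume "A \<in> kernel (homology C d q) (homology Q dQ q) ?p"
    then obtain z where z: "z \<in> cycles C d q" and A: "A = homology_class C d q z"
      and "\<pi> q z \<in> boundaries Q dQ q"
      by (auto simp: kernel_def carrier_homology projection.homology_induced_class
          Q.homology_class_eq_one_iff projection.h_closed cycles_closed)
    then obtain b where b: "b \<in> carrier (C (q + 1))"
      and w: "z \<otimes>\<^bsub>C q\<^esub> inv\<^bsub>C q\<^esub> d (q + 1) b \<in> carrier (D q)" (is "?w \<in> _")
      by (auto simp: proj_in_boundaries_iff cycles_closed)
    \<comment> \<open>The cycle \<open>w = z - d b\<close> lies in \<open>D\<close> and is homologous to \<open>z\<close> in \<open>C\<close>.\<close>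
    have db: "d (q + 1) b \<in> boundaries C d q" using b by (simp add: boundaries_def)
    then have dbz: "d (q + 1) b \<in> cycles C d q" using boundaries_subset_cycles by blast
    have "?w \<in> cycles C d q"
      using z dbz subgroup_cycles by (simp add: subgroup.m_closed subgroup.m_inv_closed)
    then have wD: "?w \<in> cycles D d q"
      using w by (simp add: cycles_iff D.cycles_iff)
    have zc: "z \<in> carrier (C q)" and dbc: "d (q + 1) b \<in> carrier (C q)"
      using z dbz cycles_closed by blast+
    have "z \<otimes>\<^bsub>C q\<^esub> inv\<^bsub>C q\<^esub> ?w = d (q + 1) b"
      using zc dbc by (rule G.mult_inv_mult_inv)
    then have "homology_class C d q z = homology_class C d q ?w"
      using zc dbc db by (simp add: homology_class_eq_iff)
    then have "A = ?i (homology_class D d q ?w)"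
      by (simp add: A inclusion.homology_induced_class[OF wD])
    then show "A \<in> ?i ` carrier (homology D d q)"
      using D.homology_class_closed[OF wD] by blast
  qed
  then show ?thesis
    by (simp add: exact_at_def inclusion.group_hom_homology_induced
        projection.group_hom_homology_induced)
qed

lemma exact_at_quotient:
  "exact_at (homology C d q) (homology_induced Q dQ \<pi> q) (homology Q dQ q)
    (connecting_map C D d q) (homology D d (q - 1))"
proof -
  interpret G: comm_group "C q" by (rule comm_group_chain)
  interpret G': comm_group "C (q - 1)" by (rule comm_group_chain)
  let ?p = "homology_induced Q dQ \<pi> q"
  have "?p ` carrier (homology C d q) =
      kernel (homology Q dQ q) (homology D d (q - 1)) (connecting_map C D d q)"
  proof (intro subset_antisym subsetI)
    fix A assume "A \<in> ?p ` carrier (homology C d q)"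
    then obtain z where z: "z \<in> cycles C d q" and A: "A = homology_class Q dQ q (\<pi> q z)"
      by (auto simp: carrier_homology projection.homology_induced_class)
    have zc: "z \<in> carrier (C q)" and dz: "d q z = \<one>\<^bsub>C (q - 1)\<^esub>"
      using z by (auto simp: cycles_iff)
    have "d q z \<in> boundaries D d (q - 1)"
      using subgroup.one_closed[OF D.subgroup_boundaries, of "q - 1"] by (simp add: dz)
    moreover have dD: "d q z \<in> carrier (D (q - 1))"
      using subgroup.one_closed[OF subgroup_D] by (simp add: dz)
    ultimately show "A \<in> kernel (homology Q dQ q) (homology D d (q - 1)) (connecting_map C D d q)"
      using zc by (simp add: kernel_def A connecting_map_class D.homology_class_eq_one_iff
          Q.homology_class_closed proj_cycle_iff)
  next
    fix A assume "A \<in> kernel (homology Q dQ q) (homology D d (q - 1)) (connecting_map C D d q)"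
    then obtain c where c: "c \<in> carrier (C q)" and A: "A = homology_class Q dQ q (\<pi> q c)"
      and "d q c \<in> boundaries D d (q - 1)"
      by (auto simp: kernel_def carrier_relative_homology connecting_map_class
          D.homology_class_eq_one_iff)
    then obtain e where e: "e \<in> carrier (D q)" and dc: "d q c = d q e"
      by (auto simp: boundaries_def)
    \<comment> \<open>\<open>c\<close> and the correction \<open>c - e\<close> have the same coset, and the latter is a cycle of \<open>C\<close>.\<close>
    let ?z = "c \<otimes>\<^bsub>C q\<^esub> inv\<^bsub>C q\<^esub> e"
    have ec: "e \<in> carrier (C q)" by (rule D_closed[OF e])
    have "d q ?z = \<one>\<^bsub>C (q - 1)\<^esub>"
      using c ec d_closed[OF ec] hom_mult[OF d_hom c, of "inv\<^bsub>C q\<^esub> e"]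
        group_hom.hom_inv[OF group_hom_d ec]
      by (simp add: dc)
    then have z: "?z \<in> cycles C d q" using c ec by (simp add: cycles_iff)
    have "inv\<^bsub>C q\<^esub> e \<in> carrier (D q)"
      by (rule subgroup.m_inv_closed[OF subgroup_D e])
    moreover have "?z \<otimes>\<^bsub>C q\<^esub> inv\<^bsub>C q\<^esub> c = inv\<^bsub>C q\<^esub> e"
      using c ec by (simp add: G.mult_inv_mult_inv)
    ultimately have "\<pi> q ?z = \<pi> q c"
      using c ec by (simp add: proj_eq_iff)
    then have "A = ?p (homology_class C d q ?z)"
      by (simp add: A projection.homology_induced_class[OF z])
    then show "A \<in> ?p ` carrier (homology C d q)"
      using homology_class_closed[OF z] by blast
  qed
  then show ?thesis
    by (simp add: exact_at_def projection.group_hom_homology_induced group_hom_connecting_map)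
qed

text \<open>
  Here no correction is needed: a class of \<open>D\<close> is a value of the connecting map, as well as killed by
  the inclusion, precisely when its representatives are boundaries of chains of \<open>C\<close>.
\<close>

lemma exact_at_subcomplex:
  "exact_at (homology Q dQ q) (connecting_map C D d q) (homology D d (q - 1))
    (homology_induced C d (\<lambda>q c. c) (q - 1)) (homology C d (q - 1))"
proof -
  let ?i = "homology_induced C d (\<lambda>q c. c) (q - 1)"
  have "connecting_map C D d q ` carrier (homology Q dQ q) =
      {homology_class D d (q - 1) (d q c) | c. c \<in> carrier (C q) \<and> d q c \<in> carrier (D (q - 1))}"
    by (auto simp: carrier_relative_homology connecting_map_class image_image)
  also have "\<dots> = homology_class D d (q - 1) ` (cycles D d (q - 1) \<inter> boundaries C d (q - 1))"
    using d_in_cycles_D by (fastforce simp: boundaries_def dest: D.cycles_closed)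
  also have "\<dots> = kernel (homology D d (q - 1)) (homology C d (q - 1)) ?i"
  proof -
    have "?i (homology_class D d (q - 1) z) = \<one>\<^bsub>homology C d (q - 1)\<^esub> \<longleftrightarrow>
        z \<in> boundaries C d (q - 1)" if "z \<in> cycles D d (q - 1)" for z
      using that homology_class_eq_one_iff[OF D_closed[OF D.cycles_closed]]
      by (simp add: inclusion.homology_induced_class)
    then show ?thesis
      by (auto simp: kernel_def D.carrier_homology)
  qed
  finally show ?thesis
    by (simp add: exact_at_def group_hom_connecting_map inclusion.group_hom_homology_induced)
qed

end
section \<open>The simplicial chain complex\<close>

text \<open>
  Closure under non-empty faces, by which the boundary of a chain of \<open>K\<close> is again a chain of \<open>K\<close>.
\<close>

definition face_closed :: "'v set set \<Rightarrow> bool" where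
  "face_closed K \<longleftrightarrow> (\<forall>S\<in>K. \<forall>T\<subseteq>S. T \<noteq> {} \<longrightarrow> T \<in> K)"

lemma face_closedD: "face_closed K \<Longrightarrow> S \<in> K \<Longrightarrow> T \<subseteq> S \<Longrightarrow> T \<noteq> {} \<Longrightarrow> T \<in> K"
  by (auto simp: face_closed_def)

text \<open>
  Chains that are multiplied by the sign of the permutation when the vertices of a simplex are
  reordered.
\<close>

definition alternating :: "('v list \<Rightarrow>\<^sub>0 int) \<Rightarrow> bool" where
  "alternating c \<longleftrightarrow> (\<forall>xs p. p permutes {..<length xs} \<longrightarrow>
     Poly_Mapping.lookup c (permute_list p xs) = sign p * Poly_Mapping.lookup c xs)"

lemma alternatingD:
  "alternating c \<Longrightarrow> p permutes {..<length xs} \<Longrightarrow>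
    Poly_Mapping.lookup c (permute_list p xs) = sign p * Poly_Mapping.lookup c xs"
  by (simp add: alternating_def)

lemma carrier_simplicial_chains:
  "carrier (simplicial_chains K q) =
    {c. Poly_Mapping.keys c \<subseteq> ordered_simplices K q \<and> alternating c}"
  by (simp add: simplicial_chains_def alternating_def)

lemma mult_simplicial_chains [simp]: "a \<otimes>\<^bsub>simplicial_chains K q\<^esub> b = a + b"
  and one_simplicial_chains [simp]: "\<one>\<^bsub>simplicial_chains K q\<^esub> = 0"
  by (simp_all add: simplicial_chains_def)

lemma subgroup_simplicial_chains:
  assumes "L \<subseteq> K"
  shows "subgroup (carrier (simplicial_chains L q)) (free_Abelian_group (ordered_simplices K q))"
proof -
  have sub: "ordered_simplices L q \<subseteq> ordered_simplices K q"
    using assms by (auto simp: ordered_simplices_def)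
  show ?thesis
  proof (rule group.subgroupI[OF group_free_Abelian_group])
    show "carrier (simplicial_chains L q) \<subseteq> carrier (free_Abelian_group (ordered_simplices K q))"
      using sub by (auto simp: carrier_simplicial_chains)
    show "carrier (simplicial_chains L q) \<noteq> {}"
      by (auto simp: carrier_simplicial_chains alternating_def intro!: exI[of _ 0])
  next
    fix a assume a: "a \<in> carrier (simplicial_chains L q)"
    then have "Poly_Mapping.keys a \<subseteq> ordered_simplices K q"
      using sub by (auto simp: carrier_simplicial_chains)
    then show "inv\<^bsub>free_Abelian_group (ordered_simplices K q)\<^esub> a \<in> carrier (simplicial_chains L q)"
      using a by (simp add: carrier_simplicial_chains alternating_def)
  next
    fix a b assume "a \<in> carrier (simplicial_chains L q)" "b \<in> carrier (simplicial_chains L q)"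
    then show "a \<otimes>\<^bsub>free_Abelian_group (ordered_simplices K q)\<^esub> b \<in> carrier (simplicial_chains L q)"
      using keys_add[of a b]
      by (auto simp: carrier_simplicial_chains alternating_def lookup_add distrib_left)
  qed
qed

lemma comm_group_simplicial_chains: "comm_group (simplicial_chains K q)"
  using comm_group.comm_group_subgroup[OF abelian_free_Abelian_group
      subgroup_simplicial_chains[OF subset_refl]]
  by (simp add: simplicial_chains_def)

lemma permute_list_transpose_01:
  "permute_list (Transposition.transpose 0 1) (x # y # zs) = y # x # zs"
proof -
  have "Transposition.transpose 0 1 permutes {..<length (x # y # zs)}"
    by (intro permutes_swap_id) auto
  then show ?thesis
    by (intro nth_equalityI)
       (auto simp: permute_list_nth Transposition.transpose_def nth_Cons split: nat.splits)
qed

text \<open>A permutation of the positions of \<open>ys\<close> extends to \<open>w # ys\<close>, fixing the head and keeping the sign.\<close>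

lemma permute_list_Cons:
  assumes p: "p permutes {..<length ys}"
  obtains p' where "p' permutes {..<length (w # ys)}" and "sign p' = sign p"
    and "permute_list p' (w # ys) = w # permute_list p ys"
proof
  let ?m = "length ys"
  let ?p = "map_permutation {..<?m} Suc p"
  have "?p permutes Suc ` {..<?m}"
    using p by (intro map_permutation_permutes) (auto simp: bij_betw_def)
  then show p': "?p permutes {..<length (w # ys)}"
    by (rule permutes_subset) auto
  show "sign ?p = sign p"
    using p by (simp add: sign_map_permutation)
  have 0: "?p 0 = 0"
    using \<open>?p permutes Suc ` {..<?m}\<close> by (rule permutes_not_in) auto
  have Suc: "?p (Suc n) = Suc (p n)" if "n < ?m" for n
    using that p by (subst map_permutation_apply) auto
  have "permute_list ?p (w # ys) ! n = (w # permute_list p ys) ! n" if "n < Suc ?m" for n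
    using that p p' by (cases n) (simp_all add: permute_list_nth 0 Suc)
  then show "permute_list ?p (w # ys) = w # permute_list p ys"
    by (intro nth_equalityI) simp_all
qed

text \<open>
  The empty list has to be excluded since it is its own tail; no simplex of dimension at least \<open>0\<close> is
  affected.
\<close>

lemma lookup_frag_extend_tl:
  assumes "[] \<notin> Poly_Mapping.keys c"
  shows "Poly_Mapping.lookup (frag_extend (\<lambda>xs. frag_of (tl xs)) c) ys =
    (\<Sum>w | w # ys \<in> Poly_Mapping.keys c. Poly_Mapping.lookup c (w # ys))"
proof -
  let ?k = "Poly_Mapping.keys c"
  have img: "{xs \<in> ?k. tl xs = ys} = (\<lambda>w. w # ys) ` {w. w # ys \<in> ?k}"
  proof (intro equalityI subsetI)
    fix xs assume "xs \<in> {xs \<in> ?k. tl xs = ys}"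
    with assms show "xs \<in> (\<lambda>w. w # ys) ` {w. w # ys \<in> ?k}" by (cases xs) auto
  qed auto
  have "Poly_Mapping.lookup (frag_extend (\<lambda>xs. frag_of (tl xs)) c) ys =
      (\<Sum>xs\<in>?k. Poly_Mapping.lookup c xs * (if tl xs = ys then 1 else 0))"
    by (auto simp: frag_extend_def lookup_sum intro!: sum.cong)
  also have "\<dots> = (\<Sum>xs | xs \<in> ?k \<and> tl xs = ys. Poly_Mapping.lookup c xs)"
    by (intro sum.mono_neutral_cong_right) auto
  also have "\<dots> = (\<Sum>w | w # ys \<in> ?k. Poly_Mapping.lookup c (w # ys))"
    unfolding img by (subst sum.reindex) (auto simp: inj_on_def)
  finally show ?thesis .
qed

lemma alternating_frag_extend_tl:
  assumes c: "alternating c" and ne: "[] \<notin> Poly_Mapping.keys c"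
  shows "alternating (frag_extend (\<lambda>xs. frag_of (tl xs)) c)"
  unfolding alternating_def
proof (intro allI impI)
  fix ys :: "'a list" and p assume p: "p permutes {..<length ys}"
  have lk: "Poly_Mapping.lookup c (w # permute_list p ys) = sign p * Poly_Mapping.lookup c (w # ys)"
    for w
    using permute_list_Cons[OF p, of w] alternatingD[OF c, of _ "w # ys"] by metis
  have "w # permute_list p ys \<in> Poly_Mapping.keys c \<longleftrightarrow> w # ys \<in> Poly_Mapping.keys c" for w
    by (simp add: in_keys_iff lk sign_nz)
  then show "Poly_Mapping.lookup (frag_extend (\<lambda>xs. frag_of (tl xs)) c) (permute_list p ys) =
      sign p * Poly_Mapping.lookup (frag_extend (\<lambda>xs. frag_of (tl xs)) c) ys"
    by (simp add: lookup_frag_extend_tl[OF ne] lk sum_distrib_left)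
qed

text \<open>
  Reindexing the sum that defines \<open>frag_extend g c\<close> by the swap of the first two vertices leaves \<open>g\<close>
  unchanged and negates the coefficients of \<open>c\<close>, so the sum is its own negative.
\<close>

lemma frag_extend_alternating_eq_0:
  assumes c: "alternating c"
    and len: "\<And>xs. xs \<in> Poly_Mapping.keys c \<Longrightarrow> 2 \<le> length xs"
    and g: "\<And>x y zs. g (x # y # zs) = g (y # x # zs)"
  shows "frag_extend g c = 0"
proof -
  define \<sigma> :: "'a list \<Rightarrow> 'a list" where "\<sigma> = permute_list (Transposition.transpose 0 1)"
  let ?k = "Poly_Mapping.keys c"
  have \<sigma>: "\<sigma> (x # y # zs) = y # x # zs" for x y zs
    unfolding \<sigma>_def by (rule permute_list_transpose_01)
  have two: "\<exists>x y zs. xs = x # y # zs" if "xs \<in> ?k" for xs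
    using len[OF that] by (auto simp: numeral_2_eq_2 Suc_le_length_iff)
  have lk: "Poly_Mapping.lookup c (\<sigma> xs) = - Poly_Mapping.lookup c xs" if "xs \<in> ?k" for xs
  proof -
    have "Transposition.transpose 0 1 permutes {..<length xs}"
      using len[OF that] by (intro permutes_swap_id) auto
    from alternatingD[OF c this] show ?thesis
      by (simp add: \<sigma>_def sign_swap_id)
  qed
  have \<sigma>k: "\<sigma> xs \<in> ?k" if "xs \<in> ?k" for xs
    using that by (simp add: in_keys_iff lk)
  have inv: "\<sigma> (\<sigma> xs) = xs" and g\<sigma>: "g (\<sigma> xs) = g xs" if "xs \<in> ?k" for xs
    using two[OF that] by (auto simp: \<sigma> g)
  have minus: "frag_cmul (- a) b = - frag_cmul a b" for a and b :: "'b \<Rightarrow>\<^sub>0 int"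
    using frag_cmul_diff_distrib[of 0 a b] by simp
  have "frag_extend g c = (\<Sum>xs\<in>?k. frag_cmul (Poly_Mapping.lookup c (\<sigma> xs)) (g (\<sigma> xs)))"
    unfolding frag_extend_def
    by (rule sum.reindex_bij_witness[where i = \<sigma> and j = \<sigma>]) (auto simp: inv \<sigma>k)
  also have "\<dots> = (\<Sum>xs\<in>?k. - frag_cmul (Poly_Mapping.lookup c xs) (g xs))"
    by (rule sum.cong[OF refl]) (simp only: lk g\<sigma> minus)
  also have "\<dots> = - frag_extend g c"
    by (simp only: frag_extend_def sum_negf)
  finally have eq: "frag_extend g c = - frag_extend g c" .
  show ?thesis
  proof (rule poly_mapping_eqI)
    fix i
    have "Poly_Mapping.lookup (frag_extend g c) i = - Poly_Mapping.lookup (frag_extend g c) i"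
      by (subst eq) simp
    then show "Poly_Mapping.lookup (frag_extend g c) i = Poly_Mapping.lookup 0 i"
      by simp
  qed
qed

lemma simplicial_boundary_closed:
  assumes K: "face_closed K" and c: "c \<in> carrier (simplicial_chains K q)"
  shows "simplicial_boundary q c \<in> carrier (simplicial_chains K (q - 1))"
proof (cases "q \<le> 0")
  case True
  then show ?thesis
    by (simp add: simplicial_boundary_def carrier_simplicial_chains alternating_def)
next
  case False
  have keys: "Poly_Mapping.keys c \<subseteq> ordered_simplices K q" and alt: "alternating c"
    using c by (auto simp: carrier_simplicial_chains)
  have face: "tl xs \<in> ordered_simplices K (q - 1)" if "xs \<in> Poly_Mapping.keys c" for xs
  proof -
    have xs: "distinct xs" "set xs \<in> K" "int (length xs) = q + 1"
      using keys that by (auto simp: ordered_simplices_def)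
    with False obtain x y zs where xyz: "xs = x # y # zs"
      by (cases xs; cases "tl xs") auto
    have "set (tl xs) \<in> K"
      by (rule face_closedD[OF K xs(2)]) (auto simp: xyz)
    then show ?thesis
      using xs by (simp add: ordered_simplices_def xyz)
  qed
  have "[] \<notin> Poly_Mapping.keys c"
    using keys False by (auto simp: ordered_simplices_def)
  then show ?thesis
    using False face keys_frag_extend[of "\<lambda>xs. frag_of (tl xs)" c] alternating_frag_extend_tl[OF alt]
    by (auto simp: simplicial_boundary_def carrier_simplicial_chains)
qed

lemma simplicial_boundary_boundary:
  assumes "c \<in> carrier (simplicial_chains K (q + 1))"
  shows "simplicial_boundary q (simplicial_boundary (q + 1) c) = 0"
proof (cases "q \<le> 0")
  case True
  then show ?thesis by (simp add: simplicial_boundary_def)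
next
  case False
  \<comment> \<open>The twofold boundary removes the first two vertices of every ordered simplex.\<close>
  have "frag_extend ((\<lambda>xs. frag_of (tl xs)) \<circ> tl) c = 0"
  proof (rule frag_extend_alternating_eq_0)
    show "2 \<le> length xs" if "xs \<in> Poly_Mapping.keys c" for xs
      using assms that False by (auto simp: carrier_simplicial_chains ordered_simplices_def)
  qed (use assms in \<open>auto simp: carrier_simplicial_chains\<close>)
  then show ?thesis
    using False frag_extend_compose[of "\<lambda>xs. frag_of (tl xs)" tl c]
    by (simp add: simplicial_boundary_def o_def)
qed

lemma simplicial_boundary_add:
  "simplicial_boundary q (a + b) = simplicial_boundary q a + simplicial_boundary q b"
  by (simp add: simplicial_boundary_def frag_extend_add)

lemma chain_complex_simplicial:
  assumes "face_closed K"
  shows "chain_complex (simplicial_chains K) simplicial_boundary"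
proof (rule chain_complex.intro)
  show "simplicial_boundary q \<in> hom (simplicial_chains K q) (simplicial_chains K (q - 1))" for q
    by (rule homI) (simp_all add: simplicial_boundary_closed[OF assms] simplicial_boundary_add)
qed (simp_all add: comm_group_simplicial_chains simplicial_boundary_boundary)

lemma chain_subcomplex_simplicial:
  assumes K: "face_closed K" and L: "face_closed L" and "L \<subseteq> K"
  shows "chain_subcomplex (simplicial_chains K) simplicial_boundary (simplicial_chains L)"
proof (rule chain_subcomplex.intro)
  show "chain_complex (simplicial_chains K) simplicial_boundary"
    by (rule chain_complex_simplicial[OF K])
  show "chain_subcomplex_axioms (simplicial_chains K) simplicial_boundary (simplicial_chains L)"
  proof (rule chain_subcomplex_axioms.intro)
    show "subgroup (carrier (simplicial_chains L q)) (simplicial_chains K q)" for q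
    proof -
      have "carrier (simplicial_chains L q) \<subseteq> carrier (simplicial_chains K q)"
        using \<open>L \<subseteq> K\<close> by (auto simp: carrier_simplicial_chains ordered_simplices_def)
      then show ?thesis
        using group.subgroup_incl[OF comm_group.axioms(2)[OF abelian_free_Abelian_group]
            subgroup_simplicial_chains[OF \<open>L \<subseteq> K\<close>] subgroup_simplicial_chains[OF subset_refl]]
        by (simp add: simplicial_chains_def)
    qed
    show "(simplicial_chains K q)\<lparr>carrier := carrier (simplicial_chains L q)\<rparr> = simplicial_chains L q"
      for q
      by (simp add: simplicial_chains_def free_Abelian_group_def)
  qed (rule simplicial_boundary_closed[OF L])
qed

section \<open>The subcomplex of the nerve\<close>

lemma word_map_append:
  "word_map f j (u @ v) = word_map f j u \<circ> word_map f (j + length u) v"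
  by (induction u arbitrary: j) auto

lemma words_append:
  assumes u: "u \<in> words I j k" and v: "v \<in> words I k l" and "j \<le> k" and "k \<le> l"
  shows "u @ v \<in> words I j l"
proof -
  have "(u @ v) ! n \<in> I (j + n + 1)" if n: "n < l - j" for n
  proof (cases "n < k - j")
    case True
    then show ?thesis using u by (simp add: words_def nth_append)
  next
    case False
    then have "n - (k - j) < l - k" and "k + (n - (k - j)) = j + n"
      using n assms by auto
    then have "v ! (n - (k - j)) \<in> I (j + n + 1)"
      using v unfolding words_def by (metis (mono_tags, lifting) mem_Collect_eq)
    then show ?thesis using u False by (simp add: words_def nth_append)
  qed
  then show ?thesis using assms by (auto simp: words_def)
qed

lemma face_closed_nerve: "face_closed (nerve X I f j k)"
  unfolding face_closed_def nerve_def
proof (intro ballI allI impI CollectI conjI)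
  fix S T
  assume S: "S \<in> {S. finite S \<and> S \<noteq> {} \<and> S \<subseteq> words I j k \<and>
      (\<Inter>v\<in>S. word_map f j v ` shifted_limit_set X I f k) \<noteq> {}}"
    and T: "T \<subseteq> S" "T \<noteq> {}"
  show "finite T" "T \<noteq> {}" "T \<subseteq> words I j k"
    using S T by (auto intro: finite_subset)
  show "(\<Inter>v\<in>T. word_map f j v ` shifted_limit_set X I f k) \<noteq> {}"
  proof -
    obtain x where "\<And>v. v \<in> S \<Longrightarrow> x \<in> word_map f j v ` shifted_limit_set X I f k"
      using S by (auto simp only: mem_Collect_eq ex_in_conv[symmetric] INT_iff)
    then have "x \<in> (\<Inter>v\<in>T. word_map f j v ` shifted_limit_set X I f k)"
      using T(1) by (simp add: subset_iff)
    then show ?thesis by blast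
  qed
qed

lemma face_closed_nerve_subcomplex: "face_closed (nerve_subcomplex X I f j k l)"
  unfolding face_closed_def
proof (intro ballI allI impI)
  fix S T
  assume "S \<in> nerve_subcomplex X I f j k l" and T: "T \<subseteq> S" "T \<noteq> {}"
  then obtain u R where u: "u \<in> words I j k" and R: "R \<in> nerve X I f k l" and S: "S = (@) u ` R"
    by (auto simp: nerve_subcomplex_def)
  obtain R' where R': "R' \<subseteq> R" "T = (@) u ` R'"
    using T(1) S by (auto simp: subset_image_iff)
  have "R' \<in> nerve X I f k l"
    by (rule face_closedD[OF face_closed_nerve R R'(1)]) (use T R' in auto)
  with u R' show "T \<in> nerve_subcomplex X I f j k l"
    by (auto simp: nerve_subcomplex_def)
qed

lemma nerve_subcomplex_subset_nerve:
  assumes "j \<le> k" "k \<le> l"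
  shows "nerve_subcomplex X I f j k l \<subseteq> nerve X I f j l"
proof
  fix S assume "S \<in> nerve_subcomplex X I f j k l"
  then obtain u R where u: "u \<in> words I j k" and R: "R \<in> nerve X I f k l" and S: "S = (@) u ` R"
    by (auto simp: nerve_subcomplex_def)
  obtain x where x: "x \<in> (\<Inter>v\<in>R. word_map f k v ` shifted_limit_set X I f l)"
    using R by (auto simp: nerve_def)
  have len: "j + length u = k"
    using u \<open>j \<le> k\<close> by (simp add: words_def)
  have "word_map f j u x \<in> word_map f j (u @ v) ` shifted_limit_set X I f l" if "v \<in> R" for v
    using x that by (auto simp: word_map_append len)
  then have "(\<Inter>w\<in>S. word_map f j w ` shifted_limit_set X I f l) \<noteq> {}"
    using S by blast
  then show "S \<in> nerve X I f j l"
    using R S u words_append[OF u _ assms] by (auto simp: nerve_def)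
qed

theorem theorem6:
  fixes X :: "'a::metric_space set"
    and I :: "nat \<Rightarrow> 'i set"
    and f :: "nat \<Rightarrow> 'i \<Rightarrow> 'a \<Rightarrow> 'a"
    and j k l :: nat
    and N M :: "'i list set set"
  assumes "nonautonomous_IFS X I f"
    and "j < k" and "k < l"
    and "N = nerve X I f j l"
    and "M = nerve_subcomplex X I f j k l"
  shows "\<forall>q::int.
      exact_at (simplicial_homology M q) (homology_inclusion N q)
               (simplicial_homology N q) (homology_projection N M q)
               (relative_simplicial_homology N M q) \<and>
      exact_at (simplicial_homology N q) (homology_projection N M q)
               (relative_simplicial_homology N M q) (homology_connecting N M q)
               (simplicial_homology M (q - 1)) \<and>
      exact_at (relative_simplicial_homology N M q) (homology_connecting N M q)
               (simplicial_homology M (q - 1)) (homology_inclusion N (q - 1))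
               (simplicial_homology N (q - 1))"
proof -
  have "face_closed N" "face_closed M" "M \<subseteq> N"
    using assms face_closed_nerve face_closed_nerve_subcomplex
      nerve_subcomplex_subset_nerve[of j k l X I f] by simp_all
  then interpret chain_subcomplex "simplicial_chains N" simplicial_boundary "simplicial_chains M"
    by (rule chain_subcomplex_simplicial)
  show ?thesis
    using exact_at_complex exact_at_quotient exact_at_subcomplex
    by (simp add: simplicial_homology_def relative_simplicial_homology_def
        homology_inclusion_def homology_projection_def homology_connecting_def)
qed

end
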